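(* Let $X$ and $Y$ be prebornological spaces, let $f\colon X\to Y$ be a map, and let $x\in X$. The following are equivalent: (1) $f$ is bornological at $x$; (2) ${}^{\ast}f\left(G_{X}(x)\right)\subseteq G_{Y}\left(f(x)\right)$.
   Context: Nonstandard setting: fix a transitive universe $\mathbb{U}$ (the standard universe) satisfying sufficiently many axioms of ZFC and containing all standard objects considered, and a $|\mathbb{U}|^{+}$-saturated enlargement $\ast\colon\mathbb{U}\hookrightarrow{}^{\ast}\mathbb{U}$ (so transfer, i.e. elementary extension, and saturation are available). A standard set $X$ is regarded as a subset of ${}^{\ast}X$ by identifying $x$ with ${}^{\ast}x$. A prebornology on a set $X$ is a nonempty $\mathcal{B}_{X}\subseteq\mathcal{P}(X)$ such that (i) $\bigcup\mathcal{B}_{X}=X$; (ii) $B\in\mathcal{B}_{X}$ and $C\subseteq B$ imply $C\in\mathcal{B}_{X}$; (iii) $B,C\in\mathcal{B}_{X}$ and $B\cap C\neq\varnothing$ imply $B\cup C\in\mathcal{B}_{X}$. The pair $(X,\mathcal{B}_{X})$ is a prebornological space; elements of $\mathcal{B}_{X}$ are called bounded sets. For $x\in X$, $\mathcal{BN}_{X}(x)=\{B\in\mathcal{B}_{X}: x\in B\}$, and the galaxy of $x$ is $G_{X}(x)=\bigcup_{B\in\mathcal{BN}_{X}(x)}{}^{\ast}B\subseteq{}^{\ast}X$. A map $f\colon X\to Y$ between prebornological spaces is bornological at $x\in X$ if $f(B)\in\mathcal{BN}_{Y}(f(x))$ for every $B\in\mathcal{BN}_{X}(x)$. *)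

theory Defs
  imports Main "HOL-Library.Equipollence"
begin

section \<open>Structures for the language of set theory\<close>

text \<open>
  HOL has no ambient universe of sets, so a structure for the language of set theory is a
  binary relation \<open>mem\<close> on a type, with \<open>mem a b\<close> read as "a is an element of b".
  \<open>elts mem a\<close> is the external (HOL) set of the elements of \<open>a\<close>.
\<close>

definition elts :: "('u \<Rightarrow> 'u \<Rightarrow> bool) \<Rightarrow> 'u \<Rightarrow> 'u set" where
  "elts mem a = {z. mem z a}"

datatype fm = FMem nat nat | FEq nat nat | FNeg fm | FConj fm fm | FEx nat fm

primrec sat :: "('u \<Rightarrow> 'u \<Rightarrow> bool) \<Rightarrow> fm \<Rightarrow> (nat \<Rightarrow> 'u) \<Rightarrow> bool" where
  "sat mem (FMem i j) e \<longleftrightarrow> mem (e i) (e j)"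
| "sat mem (FEq i j) e \<longleftrightarrow> e i = e j"
| "sat mem (FNeg p) e \<longleftrightarrow> \<not> sat mem p e"
| "sat mem (FConj p q) e \<longleftrightarrow> sat mem p e \<and> sat mem q e"
| "sat mem (FEx i p) e \<longleftrightarrow> (\<exists>a. sat mem p (e(i := a)))"

text \<open>
  The standard universe. By Mostowski's collapse, the transitive sets are up to isomorphism
  exactly the structures that are extensional and (externally) well-founded. The remaining
  clauses are pairing, union, infinity, the full separation schema (variable 0 is the
  separated one, the other variables are parameters) and choice. This is the part of ZFC that
  holds in all the usual choices of a standard universe: transitive models of ZFC, the
  \<open>V\<^sub>\<lambda>\<close> for limit \<open>\<lambda> > \<omega>\<close> (where replacement may fail) and the \<open>H\<^sub>\<kappa>\<close> for regular
  uncountable \<open>\<kappa>\<close> (where power set may fail).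
\<close>

definition standard_universe :: "('u \<Rightarrow> 'u \<Rightarrow> bool) \<Rightarrow> bool" where
  "standard_universe mem \<longleftrightarrow>
     inj (elts mem) \<and>
     wfp mem \<and>
     (\<forall>a b. \<exists>c. elts mem c = {a, b}) \<and>
     (\<forall>a. \<exists>c. elts mem c = \<Union> (elts mem ` elts mem a)) \<and>
     (\<exists>a. (\<exists>z \<in> elts mem a. elts mem z = {}) \<and>
          (\<forall>y \<in> elts mem a. \<exists>s \<in> elts mem a. elts mem s = insert y (elts mem y))) \<and>
     (\<forall>p e a. \<exists>c. elts mem c = {z \<in> elts mem a. sat mem p (e(0 := z))}) \<and>
     (\<forall>a. (\<forall>y \<in> elts mem a. elts mem y \<noteq> {}) \<and>
          (\<forall>y \<in> elts mem a. \<forall>z \<in> elts mem a. y \<noteq> z \<longrightarrow> elts mem y \<inter> elts mem z = {}) \<longrightarrow>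
          (\<exists>c. \<forall>y \<in> elts mem a. \<exists>!z. z \<in> elts mem c \<inter> elts mem y))"

definition elementary_embedding ::
  "('u \<Rightarrow> 'u \<Rightarrow> bool) \<Rightarrow> ('v \<Rightarrow> 'v \<Rightarrow> bool) \<Rightarrow> ('u \<Rightarrow> 'v) \<Rightarrow> bool" where
  "elementary_embedding mem smem star \<longleftrightarrow>
     (\<forall>p e. sat mem p e \<longleftrightarrow> sat smem p (star \<circ> e))"

text \<open>
  Saturation for the successor of the cardinality of \<open>'u\<close>: every family of at most that many
  internal sets (elements of \<open>'v\<close>) with the finite intersection property has a common element.
\<close>

definition succ_card_saturated :: "'u itself \<Rightarrow> ('v \<Rightarrow> 'v \<Rightarrow> bool) \<Rightarrow> bool" where
  "succ_card_saturated U smem \<longleftrightarrow>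
     (\<forall>F :: 'v set. F \<lesssim> (UNIV :: 'u set) \<longrightarrow>
        (\<forall>F0. F0 \<subseteq> F \<and> finite F0 \<longrightarrow> (\<Inter>c \<in> F0. elts smem c) \<noteq> {}) \<longrightarrow>
        (\<Inter>c \<in> F. elts smem c) \<noteq> {})"

definition saturated_enlargement ::
  "('u \<Rightarrow> 'u \<Rightarrow> bool) \<Rightarrow> ('v \<Rightarrow> 'v \<Rightarrow> bool) \<Rightarrow> ('u \<Rightarrow> 'v) \<Rightarrow> bool" where
  "saturated_enlargement mem smem star \<longleftrightarrow>
     elementary_embedding mem smem star \<and> succ_card_saturated TYPE('u) smem"

text \<open>
  Functions inside a structure are sets of Kuratowski pairs. The same definitions are used in
  the standard universe and, for internal functions, in the enlargement.
\<close>

definition is_pair :: "('u \<Rightarrow> 'u \<Rightarrow> bool) \<Rightarrow> 'u \<Rightarrow> 'u \<Rightarrow> 'u \<Rightarrow> bool" where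
  "is_pair mem p a b \<longleftrightarrow> elts mem ` elts mem p = {{a}, {a, b}}"

definition is_map :: "('u \<Rightarrow> 'u \<Rightarrow> bool) \<Rightarrow> 'u \<Rightarrow> 'u \<Rightarrow> 'u \<Rightarrow> bool" where
  "is_map mem f X Y \<longleftrightarrow>
     (\<forall>p \<in> elts mem f. \<exists>a \<in> elts mem X. \<exists>b \<in> elts mem Y. is_pair mem p a b) \<and>
     (\<forall>a \<in> elts mem X. \<exists>!b. \<exists>p \<in> elts mem f. is_pair mem p a b)"

definition app :: "('u \<Rightarrow> 'u \<Rightarrow> bool) \<Rightarrow> 'u \<Rightarrow> 'u \<Rightarrow> 'u" where
  "app mem f a = (THE b. \<exists>p \<in> elts mem f. is_pair mem p a b)"

section \<open>Prebornological spaces\<close>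

definition prebornology :: "'a set \<Rightarrow> 'a set set \<Rightarrow> bool" where
  "prebornology X \<B> \<longleftrightarrow>
     \<B> \<noteq> {} \<and> \<B> \<subseteq> Pow X \<and>
     \<Union> \<B> = X \<and>
     (\<forall>B C. B \<in> \<B> \<and> C \<subseteq> B \<longrightarrow> C \<in> \<B>) \<and>
     (\<forall>B C. B \<in> \<B> \<and> C \<in> \<B> \<and> B \<inter> C \<noteq> {} \<longrightarrow> B \<union> C \<in> \<B>)"

definition BN :: "'a set set \<Rightarrow> 'a \<Rightarrow> 'a set set" where
  "BN \<B> x = {B \<in> \<B>. x \<in> B}"

definition bornological_at ::
  "'a set set \<Rightarrow> 'b set set \<Rightarrow> ('a \<Rightarrow> 'b) \<Rightarrow> 'a \<Rightarrow> bool" where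
  "bornological_at \<B>X \<B>Y f x \<longleftrightarrow> (\<forall>B \<in> BN \<B>X x. f ` B \<in> BN \<B>Y (f x))"

text \<open>
  The family of external sets coded by an element \<open>\<B>\<close> of the standard universe.
\<close>

definition family :: "('u \<Rightarrow> 'u \<Rightarrow> bool) \<Rightarrow> 'u \<Rightarrow> 'u set set" where
  "family mem \<B> = elts mem ` elts mem \<B>"

text \<open>
  For a standard set \<open>B\<close>, the external set of all elements of its extension is
  \<open>elts smem (star B)\<close>.
\<close>

definition galaxy ::
  "('u \<Rightarrow> 'u \<Rightarrow> bool) \<Rightarrow> ('v \<Rightarrow> 'v \<Rightarrow> bool) \<Rightarrow> ('u \<Rightarrow> 'v) \<Rightarrow> 'u \<Rightarrow> 'u \<Rightarrow> 'v set" where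
  "galaxy mem smem star \<B> x =
     (\<Union>B \<in> {B \<in> elts mem \<B>. elts mem B \<in> BN (family mem \<B>) x}. elts smem (star B))"

end

theory Submission imports Defs begin

text \<open>
  One direction is transfer alone, the other is saturation. If \<open>f\<close> maps the bounded set \<open>B\<close>
  around \<open>x\<close> into a bounded set \<open>C\<close>, then "every point of \<open>B\<close> has an \<open>f\<close>-value in \<open>C\<close>" is a
  first-order statement about standard parameters, so \<open>*f\<close> maps \<open>*B\<close> into \<open>*C\<close>, which is part of
  the galaxy of \<open>f x\<close>.

  Conversely, suppose that \<open>f ` B\<close> is unbounded. For each bounded \<open>D\<close> around \<open>f x\<close> let
  \<open>E D = {z \<in> B. f z \<notin> D}\<close>. The bounded sets around \<open>f x\<close> are closed under finite unions, because
  they all share the point \<open>f x\<close>, and \<open>f ` B\<close> is contained in none of them; so finitely many of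
  the sets \<open>E D\<close> always have a common element. There are at most as many of them as standard
  elements, so saturation gives a point \<open>z\<close> in all the \<open>*(E D)\<close>. By transfer \<open>z\<close> lies in \<open>*B\<close>,
  hence in the galaxy of \<open>x\<close>, while \<open>*f z\<close> lies in no \<open>*D\<close>, hence outside the galaxy of \<open>f x\<close>
  (\<open>galaxy_escape\<close>).

  Transfer is available only for formulas of type \<^typ>\<open>fm\<close>, so everything is phrased through the
  relation "\<open>f\<close> sends \<open>a\<close> to \<open>b\<close>", which has an explicit formula; the description operator
  in \<^const>\<open>app\<close> is eliminated by the unique existence of values, itself a transferable statement.
\<close>

section \<open>Formulas for ordered pairs and function values\<close>

definition FImp :: "fm \<Rightarrow> fm \<Rightarrow> fm" where "FImp p q = FNeg (FConj p (FNeg q))"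
definition FOr :: "fm \<Rightarrow> fm \<Rightarrow> fm" where "FOr p q = FNeg (FConj (FNeg p) (FNeg q))"
definition FIff :: "fm \<Rightarrow> fm \<Rightarrow> fm" where "FIff p q = FConj (FImp p q) (FImp q p)"
definition FAll :: "nat \<Rightarrow> fm \<Rightarrow> fm" where "FAll i p = FNeg (FEx i (FNeg p))"

lemma sat_connectives [simp]:
  "sat mem (FImp p q) e \<longleftrightarrow> (sat mem p e \<longrightarrow> sat mem q e)"
  "sat mem (FOr p q) e \<longleftrightarrow> sat mem p e \<or> sat mem q e"
  "sat mem (FIff p q) e \<longleftrightarrow> (sat mem p e \<longleftrightarrow> sat mem q e)"
  "sat mem (FAll i p) e \<longleftrightarrow> (\<forall>a. sat mem p (e(i := a)))"
  by (auto simp: FImp_def FOr_def FIff_def FAll_def)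

text \<open>
  Bound variables are numbered above the sum of the free ones, so they cannot capture them and
  the satisfaction lemmas need no freshness conditions.
\<close>

definition upair_fm :: "nat \<Rightarrow> nat \<Rightarrow> nat \<Rightarrow> fm" where
  "upair_fm s a b = (let t = Suc (s + a + b) in
     FAll t (FIff (FMem t s) (FOr (FEq t a) (FEq t b))))"

lemma sat_upair_fm [simp]:
  "sat mem (upair_fm s a b) e \<longleftrightarrow> elts mem (e s) = {e a, e b}"
  by (auto simp: upair_fm_def Let_def elts_def)

definition pair_fm :: "nat \<Rightarrow> nat \<Rightarrow> nat \<Rightarrow> fm" where
  "pair_fm p a b = (let s = Suc (p + a + b) in
     FConj (FEx s (FConj (FMem s p) (upair_fm s a a)))
       (FConj (FEx s (FConj (FMem s p) (upair_fm s a b)))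
         (FAll s (FImp (FMem s p) (FOr (upair_fm s a a) (upair_fm s a b))))))"

lemma sat_pair_fm [simp]:
  "sat mem (pair_fm p a b) e \<longleftrightarrow> is_pair mem (e p) (e a) (e b)"
proof -
  have "is_pair mem q u v \<longleftrightarrow>
      (\<exists>s. mem s q \<and> elts mem s = {u}) \<and> (\<exists>s. mem s q \<and> elts mem s = {u, v}) \<and>
      (\<forall>s. mem s q \<longrightarrow> elts mem s = {u} \<or> elts mem s = {u, v})" for q u v
  proof -
    have "is_pair mem q u v \<longleftrightarrow>
        {u} \<in> elts mem ` elts mem q \<and> {u, v} \<in> elts mem ` elts mem q \<and>
        elts mem ` elts mem q \<subseteq> {{u}, {u, v}}"
      unfolding is_pair_def by blast
    also have "elts mem q = {s. mem s q}"
      by (simp add: elts_def)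
    finally show ?thesis
      by (simp add: image_iff image_subset_iff) metis
  qed
  then show ?thesis
    by (simp add: pair_fm_def Let_def)
qed

definition sends :: "('u \<Rightarrow> 'u \<Rightarrow> bool) \<Rightarrow> 'u \<Rightarrow> 'u \<Rightarrow> 'u \<Rightarrow> bool" where
  "sends mem f a b \<longleftrightarrow> (\<exists>p \<in> elts mem f. is_pair mem p a b)"

definition sends_fm :: "nat \<Rightarrow> nat \<Rightarrow> nat \<Rightarrow> fm" where
  "sends_fm f a b = (let p = Suc (f + a + b) in FEx p (FConj (FMem p f) (pair_fm p a b)))"

lemma sat_sends_fm [simp]:
  "sat mem (sends_fm f a b) e \<longleftrightarrow> sends mem (e f) (e a) (e b)"
  by (simp add: sends_fm_def Let_def sends_def elts_def)

lemma app_eq_if_sends: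
  assumes "\<exists>!b. sends mem f a b" and "sends mem f a b"
  shows "app mem f a = b"
  using assms unfolding app_def sends_def by (rule the1_equality)

lemma app_in_iff_sends:
  assumes "\<exists>!b. sends mem f a b"
  shows "app mem f a \<in> C \<longleftrightarrow> (\<exists>b \<in> C. sends mem f a b)"
  using assms app_eq_if_sends[OF assms] by metis

lemma is_map_sends:
  assumes "is_map mem f X Y" and "a \<in> elts mem X"
  shows "\<exists>!b. sends mem f a b"
  using assms by (simp add: is_map_def sends_def)

lemma is_map_app_in:
  assumes "is_map mem f X Y" and "a \<in> elts mem X"
  shows "app mem f a \<in> elts mem Y"
proof -
  obtain b where b: "sends mem f a b"
    using is_map_sends[OF assms] by blast
  then obtain p a' b' where p: "is_pair mem p a b" "is_pair mem p a' b'" "b' \<in> elts mem Y"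
      "p \<in> elts mem f"
    using assms(1) unfolding is_map_def sends_def by blast
  then have "{{a}, {a, b}} = {{a'}, {a', b'}}"
    unfolding is_pair_def by simp
  then have "b = b'"
    by (auto simp: doubleton_eq_iff)
  then show ?thesis
    using p app_eq_if_sends[OF is_map_sends[OF assms] b] by simp
qed

section \<open>Transfer of statements about function values\<close>

text \<open>
  In each transfer below, the default value of the environment is itself one of the parameters, so
  that only the others have to be placed explicitly; a map \<open>f\<close> is read off at position \<open>2\<close>.
\<close>

lemma transfer_mem:
  assumes "elementary_embedding mem smem star"
  shows "z \<in> elts mem a \<longleftrightarrow> star z \<in> elts smem (star a)"
proof -
  let ?e = "(\<lambda>_. a)(0 := z)"
  have "sat mem (FMem 0 1) ?e \<longleftrightarrow> sat smem (FMem 0 1) (star \<circ> ?e)"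
    using assms unfolding elementary_embedding_def by blast
  then show ?thesis
    by (simp add: elts_def)
qed

lemma transfer_unique_value:
  assumes "elementary_embedding mem smem star"
    and "\<forall>z \<in> elts mem B. \<exists>!b. sends mem f z b"
  shows "\<forall>z \<in> elts smem (star B). \<exists>!b. sends smem (star f) z b"
proof -
  let ?p = "FAll 0 (FImp (FMem 0 1)
      (FEx 3 (FConj (sends_fm 2 0 3) (FAll 4 (FImp (sends_fm 2 0 4) (FEq 4 3))))))"
  let ?e = "(\<lambda>_. f)(1 := B)"
  have "sat mem ?p ?e \<longleftrightarrow> sat smem ?p (star \<circ> ?e)"
    using assms(1) unfolding elementary_embedding_def by blast
  then show ?thesis
    using assms(2) by (simp add: elts_def Ex1_def)
qed

lemma transfer_value_in:
  assumes "elementary_embedding mem smem star"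
    and "\<forall>z \<in> elts mem B. \<exists>b \<in> elts mem C. sends mem f z b"
  shows "\<forall>z \<in> elts smem (star B). \<exists>b \<in> elts smem (star C). sends smem (star f) z b"
proof -
  let ?p = "FAll 0 (FImp (FMem 0 1) (FEx 4 (FConj (FMem 4 3) (sends_fm 2 0 4))))"
  let ?e = "(\<lambda>_. f)(1 := B, 3 := C)"
  have "sat mem ?p ?e \<longleftrightarrow> sat smem ?p (star \<circ> ?e)"
    using assms(1) unfolding elementary_embedding_def by blast
  then show ?thesis
    using assms(2) by (simp add: elts_def Bex_def)
qed

text \<open>
  The points of \<open>B\<close> without an \<open>f\<close>-value in \<open>D\<close> form a standard set whose extension has the
  same description; these extensions are the internal sets to which saturation is applied.
\<close>

lemma avoiding_set:
  assumes "standard_universe mem" and "elementary_embedding mem smem star"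
  shows "\<exists>E. elts mem E = {z \<in> elts mem B. \<not> (\<exists>b \<in> elts mem D. sends mem f z b)} \<and>
    elts smem (star E) =
      {z \<in> elts smem (star B). \<not> (\<exists>b \<in> elts smem (star D). sends smem (star f) z b)}"
proof -
  let ?p = "FNeg (FEx 5 (FConj (FMem 5 3) (sends_fm 2 0 5)))"
  let ?e = "(\<lambda>_. f)(1 := B, 3 := D)"
  have "\<forall>p e a. \<exists>c. elts mem c = {z \<in> elts mem a. sat mem p (e(0 := z))}"
    using assms(1) unfolding standard_universe_def by blast
  then obtain E where "elts mem E = {z \<in> elts mem B. sat mem ?p (?e(0 := z))}"
    by blast
  then have E: "elts mem E = {z \<in> elts mem B. \<not> (\<exists>b \<in> elts mem D. sends mem f z b)}"
    by (simp add: elts_def)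
  let ?q = "FAll 0 (FIff (FMem 0 4) (FConj (FMem 0 1) ?p))"
  have "sat mem ?q (?e(4 := E)) \<longleftrightarrow> sat smem ?q (star \<circ> (?e(4 := E)))"
    using assms(2) unfolding elementary_embedding_def by blast
  then have "elts smem (star E) =
      {z \<in> elts smem (star B). \<not> (\<exists>b \<in> elts smem (star D). sends smem (star f) z b)}"
    using E by (simp add: elts_def set_eq_iff)
  with E show ?thesis
    by (intro exI conjI)
qed

section \<open>Bounded sets around a point and galaxies\<close>

lemma BN_Union:
  assumes "prebornology X \<B>" and "x \<in> X" and "finite \<D>" and "\<D> \<subseteq> BN \<B> x"
  shows "\<exists>U \<in> BN \<B> x. \<Union> \<D> \<subseteq> U"
  using assms(3,4)
proof (induction \<D>)
  case empty
  have "x \<in> \<Union> \<B>"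
    using assms(1,2) unfolding prebornology_def by blast
  then show ?case
    by (auto simp: BN_def)
next
  case (insert D \<D>)
  then obtain U where U: "U \<in> BN \<B> x" "\<Union> \<D> \<subseteq> U"
    by blast
  then have D: "D \<in> \<B>" "U \<in> \<B>" "D \<inter> U \<noteq> {}" "x \<in> D"
    using insert.prems by (auto simp: BN_def)
  then have "D \<union> U \<in> BN \<B> x"
    using assms(1) unfolding prebornology_def BN_def by blast
  then show ?case
    using U(2) by (intro bexI[of _ "D \<union> U"]) auto
qed

lemma galaxy_image_if_bornological:
  assumes star: "elementary_embedding mem smem star"
    and \<B>X: "prebornology (elts mem X) (family mem \<B>X)"
    and f: "is_map mem f X Y"
    and born: "bornological_at (family mem \<B>X) (family mem \<B>Y) (app mem f) x"
  shows "app smem (star f) ` galaxy mem smem star \<B>X x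
    \<subseteq> galaxy mem smem star \<B>Y (app mem f x)"
proof (rule image_subsetI)
  fix z assume "z \<in> galaxy mem smem star \<B>X x"
  then obtain B where B: "elts mem B \<in> BN (family mem \<B>X) x" "z \<in> elts smem (star B)"
    unfolding galaxy_def by blast
  then have img: "app mem f ` elts mem B \<in> BN (family mem \<B>Y) (app mem f x)"
    using born unfolding bornological_at_def by blast
  then obtain C where C: "C \<in> elts mem \<B>Y" "elts mem C = app mem f ` elts mem B"
    unfolding BN_def family_def by auto
  have "elts mem B \<subseteq> elts mem X"
    using B(1) \<B>X unfolding BN_def prebornology_def by blast
  then have val: "\<forall>a \<in> elts mem B. \<exists>!b. sends mem f a b"
    using is_map_sends[OF f] by blast
  have "\<forall>a \<in> elts mem B. \<exists>b \<in> elts mem C. sends mem f a b"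
  proof
    fix a assume a: "a \<in> elts mem B"
    then have "app mem f a \<in> elts mem C"
      using C(2) by blast
    then show "\<exists>b \<in> elts mem C. sends mem f a b"
      using a val app_in_iff_sends by metis
  qed
  then have "\<exists>b \<in> elts smem (star C). sends smem (star f) z b"
    using transfer_value_in[OF star] B(2) by blast
  moreover have "\<exists>!b. sends smem (star f) z b"
    using transfer_unique_value[OF star val] B(2) by blast
  ultimately have "app smem (star f) z \<in> elts smem (star C)"
    by (simp add: app_in_iff_sends)
  moreover have "elts mem C \<in> BN (family mem \<B>Y) (app mem f x)"
    using img C(2) by simp
  ultimately show "app smem (star f) z \<in> galaxy mem smem star \<B>Y (app mem f x)"
    unfolding galaxy_def using C(1) by blast
qed

text \<open>
  This is the use of saturation. Escaping from all bounded sets around \<open>y\<close> at once is finitely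
  satisfiable, because finitely many bounded sets around \<open>y\<close> lie in a single one; and a point of
  \<open>*B\<close> whose image escapes from all their extensions has its image outside the galaxy of \<open>y\<close>.
\<close>

lemma galaxy_escape:
  fixes mem :: "'u \<Rightarrow> 'u \<Rightarrow> bool" and smem :: "'v \<Rightarrow> 'v \<Rightarrow> bool"
  assumes U: "standard_universe mem"
    and sat: "saturated_enlargement mem smem star"
    and \<B>: "prebornology (elts mem Y) (family mem \<B>)" "y \<in> elts mem Y"
    and val: "\<forall>a \<in> elts mem B. \<exists>!b. sends mem f a b"
    and unbounded: "\<And>D. D \<in> BN (family mem \<B>) y \<Longrightarrow> \<not> app mem f ` elts mem B \<subseteq> D"
  shows "\<exists>z \<in> elts smem (star B). app smem (star f) z \<notin> galaxy mem smem star \<B> y"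
proof -
  have star: "elementary_embedding mem smem star"
    and saturation: "succ_card_saturated TYPE('u) smem"
    using sat unfolding saturated_enlargement_def by auto
  define I where "I = {D \<in> elts mem \<B>. elts mem D \<in> BN (family mem \<B>) y}"
  obtain E where E_both: "\<forall>D.
      elts mem (E D) = {z \<in> elts mem B. \<not> (\<exists>b \<in> elts mem D. sends mem f z b)} \<and>
      elts smem (star (E D)) =
        {z \<in> elts smem (star B). \<not> (\<exists>b \<in> elts smem (star D). sends smem (star f) z b)}"
    using choice[OF allI, OF avoiding_set[OF U star]] by (rule exE)
  note E = conjunct1[OF spec[OF E_both]] and sE = conjunct2[OF spec[OF E_both]]
  define F where "F = (\<lambda>D. star (E D)) ` I"
  have "F \<lesssim> I"
    unfolding F_def by (rule image_lepoll)
  then have small: "F \<lesssim> (UNIV :: 'u set)"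
    using subset_imp_lepoll[of I UNIV] lepoll_trans by blast
  have "(\<Inter>c \<in> F0. elts smem c) \<noteq> {}" if F0: "F0 \<subseteq> F" "finite F0" for F0
  proof -
    obtain J where J: "J \<subseteq> I" "finite J" "F0 = (\<lambda>D. star (E D)) ` J"
      using finite_subset_image[OF F0(2) F0(1)[unfolded F_def]] by blast
    have "elts mem ` J \<subseteq> BN (family mem \<B>) y"
      using J(1) unfolding I_def by blast
    then obtain D where D: "D \<in> BN (family mem \<B>) y" "\<Union> (elts mem ` J) \<subseteq> D"
      using BN_Union[OF \<B>, of "elts mem ` J"] J(2) by blast
    then obtain a where a: "a \<in> elts mem B" "app mem f a \<notin> D"
      using unbounded by blast
    have "a \<in> elts mem (E D')" if "D' \<in> J" for D'
    proof -
      have "app mem f a \<notin> elts mem D'"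
        using a D(2) that by blast
      then show ?thesis
        unfolding E using a(1) app_in_iff_sends[OF bspec[OF val a(1)]] by simp
    qed
    then have "star a \<in> (\<Inter>c \<in> F0. elts smem c)"
      unfolding J(3) using transfer_mem[OF star] by blast
    then show ?thesis
      by blast
  qed
  then have "(\<Inter>c \<in> F. elts smem c) \<noteq> {}"
    using saturation[unfolded succ_card_saturated_def, rule_format, OF small] by simp
  then obtain z where z: "\<And>D. D \<in> I \<Longrightarrow> z \<in> elts smem (star (E D))"
    unfolding F_def by blast
  (* At least one bounded set around y is needed to place z in the extension of B. *)
  obtain D where "D \<in> BN (family mem \<B>) y"
    using BN_Union[OF \<B>, of "{}"] by blast
  then have "I \<noteq> {}"
    unfolding I_def BN_def family_def by blast
  then obtain D where "z \<in> elts smem (star (E D))"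
    using z by blast
  then have zB: "z \<in> elts smem (star B)"
    by (simp add: sE)
  have "app smem (star f) z \<notin> elts smem (star D)" if "D \<in> I" for D
    using z[OF that] app_in_iff_sends[OF bspec[OF transfer_unique_value[OF star val] zB]]
    by (simp add: sE)
  then have "app smem (star f) z \<notin> galaxy mem smem star \<B> y"
    unfolding galaxy_def I_def by blast
  then show ?thesis
    using zB by blast
qed

section \<open>Bornological maps and galaxies\<close>

theorem theorem2p24:
  fixes mem :: "'u \<Rightarrow> 'u \<Rightarrow> bool"
    and smem :: "'v \<Rightarrow> 'v \<Rightarrow> bool"
    and star :: "'u \<Rightarrow> 'v"
    and X \<B>X Y \<B>Y f x :: 'u
  assumes "standard_universe mem"
    and "saturated_enlargement mem smem star"
    and "prebornology (elts mem X) (family mem \<B>X)"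
    and "prebornology (elts mem Y) (family mem \<B>Y)"
    and "is_map mem f X Y"
    and "x \<in> elts mem X"
  shows "bornological_at (family mem \<B>X) (family mem \<B>Y) (app mem f) x \<longleftrightarrow>
         app smem (star f) ` galaxy mem smem star \<B>X x \<subseteq> galaxy mem smem star \<B>Y (app mem f x)"
    (is "?born \<longleftrightarrow> ?gal")
proof
  assume ?born
  with assms(2) show ?gal
    unfolding saturated_enlargement_def
    by (intro galaxy_image_if_bornological[OF _ assms(3,5)]) simp_all
next
  assume gal: ?gal
  show ?born
    unfolding bornological_at_def
  proof (intro ballI, rule ccontr)
    fix B' assume B': "B' \<in> BN (family mem \<B>X) x"
      and unbounded: "app mem f ` B' \<notin> BN (family mem \<B>Y) (app mem f x)"
    obtain B where B: "B \<in> elts mem \<B>X" "B' = elts mem B"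
      using B' unfolding BN_def family_def by auto
    have "elts mem B \<subseteq> elts mem X"
      using B' B(2) assms(3) unfolding BN_def prebornology_def by blast
    then have val: "\<forall>a \<in> elts mem B. \<exists>!b. sends mem f a b"
      using is_map_sends[OF assms(5)] by blast
    have "\<not> app mem f ` elts mem B \<subseteq> D" if D: "D \<in> BN (family mem \<B>Y) (app mem f x)" for D
    proof
      assume sub: "app mem f ` elts mem B \<subseteq> D"
      have "app mem f ` elts mem B \<in> family mem \<B>Y"
        using assms(4) D sub unfolding prebornology_def BN_def by blast
      then show False
        using unbounded B' B(2) unfolding BN_def by blast
    qed
    from galaxy_escape[OF assms(1,2,4) is_map_app_in[OF assms(5,6)] val this]
    obtain z where z: "z \<in> elts smem (star B)"
        "app smem (star f) z \<notin> galaxy mem smem star \<B>Y (app mem f x)"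
      by (rule bexE)
    have "z \<in> galaxy mem smem star \<B>X x"
      unfolding galaxy_def using z(1) B B' by blast
    then show False
      using gal z(2) by blast
  qed
qed

end
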